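(* Let $\eta\in(0,1)$ and let $$\lambda_n=8\sqrt2\,\sigma\sqrt{\frac{\log(p/\eta)}{n}},\qquad \mu_n=\frac{\lambda_n}{8|\widetilde J\beta^*|_\infty}.$$ Suppose that there is a constant $\phi_{\mu_n}>0$ such that, for any $\Delta\in\mathbb{R}^p$ satisfying $\sum_{j\notin\mathcal{A}^*}|\Delta_j|\le4\sum_{j\in\mathcal{A}^*}|\Delta_j|$, one has $$\Delta'K_n\Delta\ge\phi_{\mu_n}\sum_{j\in\mathcal{A}^*}\Delta_j^2.$$ Then, with probability greater than $1-\eta$, we have $$\left\|X\beta^*-X\hat\beta^{Quad}\right\|_n^2\le4\phi_{\mu_n}^{-1}\lambda_n^2|\mathcal{A}^*|,$$ $$(\beta^*-\hat\beta^{Quad})'\widetilde J(\beta^*-\hat\beta^{Quad})\le4\,\frac{|\widetilde J\beta^*|_\infty}{\phi_{\mu_n}}\lambda_n|\mathcal{A}^*|,$$ and $$|\beta^*-\hat\beta^{Quad}|_1\le8\phi_{\mu_n}^{-1}\lambda_n|\mathcal{A}^*|.$$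
   Context: Linear regression model: $X\in\mathbb{R}^{n\times p}$ is a deterministic design matrix, $\beta^*\in\mathbb{R}^p$ is the unknown parameter and $Y=X\beta^*+\varepsilon$, where $\varepsilon=(\varepsilon_1,\dots,\varepsilon_n)'$ has i.i.d. centered Gaussian entries with known variance $\sigma^2$. The sparsity set is $\mathcal{A}^*=\{j:\beta_j^*\ne 0\}$. Notation: $'$ is transposition; $\|a\|_n^2=n^{-1}\sum_{i=1}^n a_i^2$ for $a\in\mathbb{R}^n$; $|\cdot|_q$ is the usual $\ell_q$ norm of a vector ($|\cdot|_\infty$ the sup-norm) and $|S|$ the cardinality of a finite set $S$. $\mathbf{J}$ is a given (general) real $d\times p$ matrix ($d\ge1$) and $\widetilde J=\mathbf{J}'\mathbf{J}$. The estimator $\hat\beta^{Quad}$ with tuning parameters $\lambda_n,\mu_n$ is the solution of $$\min_{\beta\in\mathbb{R}^p}\left\{\|Y-X\beta\|_n^2+\lambda_n|\beta|_1+\mu_n\beta'\mathbf{J}'\mathbf{J}\beta\right\}.$$ Finally $\Psi^n=n^{-1}X'X$ and $K_n=\Psi^n+\mu_n\widetilde J$.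
   Formalization: Assumes in addition that every column of the design satisfies ‖X_j‖_n ≤ 1 (without it the claim fails, e.g. n=p=d=1, J=β*=σ=1, X=c large), and makes explicit that J̃β* ≠ 0, so that μ_n is defined. *)

theory Defs
  imports "HOL-Probability.Probability"
begin

definition emp_norm :: "real ^ 'n \<Rightarrow> real" where
  "emp_norm a = sqrt ((\<Sum>i\<in>UNIV. (a $ i)\<^sup>2) / real CARD('n))"

definition l1_norm :: "real ^ 'p \<Rightarrow> real" where
  "l1_norm b = (\<Sum>j\<in>UNIV. \<bar>b $ j\<bar>)"

definition supp :: "real ^ 'p \<Rightarrow> 'p set" where
  "supp b = {j. b $ j \<noteq> 0}"

definition quad_form :: "real ^ 'p ^ 'p \<Rightarrow> real ^ 'p \<Rightarrow> real" where
  "quad_form A v = v \<bullet> (A *v v)"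

definition Jtilde :: "real ^ 'p ^ 'd \<Rightarrow> real ^ 'p ^ 'p" where
  "Jtilde J = transpose J ** J"

definition Psi :: "real ^ 'p ^ 'n \<Rightarrow> real ^ 'p ^ 'p" where
  "Psi X = (1 / real CARD('n)) *\<^sub>R (transpose X ** X)"

definition Kmat :: "real ^ 'p ^ 'n \<Rightarrow> real ^ 'p ^ 'd \<Rightarrow> real \<Rightarrow> real ^ 'p ^ 'p" where
  "Kmat X J mu = Psi X + mu *\<^sub>R Jtilde J"

definition quad_objective ::
  "real ^ 'p ^ 'n \<Rightarrow> real ^ 'p ^ 'd \<Rightarrow> real \<Rightarrow> real \<Rightarrow> real ^ 'n \<Rightarrow> real ^ 'p \<Rightarrow> real" where
  "quad_objective X J lam mu y b =
     (emp_norm (y - X *v b))\<^sup>2 + lam * l1_norm b + mu * quad_form (Jtilde J) b"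

text \<open>Minimizers need not be unique, so being a solution of the penalized problem is a predicate.\<close>

definition is_quad_estimate ::
  "real ^ 'p ^ 'n \<Rightarrow> real ^ 'p ^ 'd \<Rightarrow> real \<Rightarrow> real \<Rightarrow> real ^ 'n \<Rightarrow> real ^ 'p \<Rightarrow> bool" where
  "is_quad_estimate X J lam mu y b \<longleftrightarrow> is_arg_min (quad_objective X J lam mu y) (\<lambda>_. True) b"

text \<open>The sup-norm of a vector is the library's \<^const>\<open>infnorm\<close>.\<close>

end

theory Submission
  imports Defs "HOL-Real_Asymp.Real_Asymp"
begin

text \<open>
  Write \<open>L = \<lambda>/8\<close>, \<open>v = X'\<epsilon>/n\<close>, \<open>d = \<beta>\<^sup>* - \<beta>hat\<close>, \<open>a = \<parallel>Xd\<parallel>\<^sub>n\<^sup>2\<close>, \<open>g = \<mu> d'Jtilde d\<close> and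
  \<open>D = a + g = d'Kd\<close>.  Split \<open>d\<close> along the support of \<open>\<beta>\<^sup>*\<close>, of size \<open>s\<close>, and let \<open>A\<close> and \<open>C\<close> be the
  \<open>\<ell>\<^sub>1\<close> norms of the two parts.  The choice of \<open>\<mu>\<close> makes every entry of \<open>\<mu> Jtilde \<beta>\<^sup>*\<close> at most \<open>L\<close> in
  absolute value, so that the ridge term enters like additional noise of size \<open>L\<close>.

  When \<open>\<bar>v\<^sub>j\<bar> \<le> L\<close> for all \<open>j\<close>, optimality of the estimate gives \<open>D \<le> L(6A - 2C)\<close>.  Hence
  \<open>C \<le> 3A\<close>, the restricted eigenvalue condition applies to \<open>d\<close>, and Cauchy--Schwarz yields
  \<open>A\<^sup>2 \<le> sD/\<phi>\<close>, so \<open>D \<le> 36 L\<^sup>2 s/\<phi>\<close> and \<open>A \<le> 6Ls/\<phi>\<close>.  The bounds on the prediction error and on the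
  \<open>\<ell>\<^sub>1\<close> error follow with room to spare.  The bound on the penalty does not: it reads
  \<open>g \<le> 32 L\<^sup>2 s/\<phi>\<close>, and 36 exceeds 32.

  The missing factor comes from two observations.  First, shrinking the estimate towards the origin
  is a second admissible perturbation; it shows that a nonzero estimate forces \<open>\<surd>a \<ge> 3L\<close>
  (\<open>nonzero_estimate_prediction_error\<close>), so that \<open>L\<surd>a \<le> a/3\<close> is absorbed by \<open>D\<close>.  Secondly, equality
  in Cauchy--Schwarz requires \<open>d\<close> to be nearly proportional, on the support, to the sign vector \<open>e\<close>
  of \<open>\<beta>\<^sup>*\<close>; along \<open>e\<close> the noise is controlled by the prediction norm, provided that
  \<open>-v'e \<le> L \<parallel>Xe\<parallel>\<^sub>n\<close>.  This is one more event on the noise, and it replaces the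
  crude \<open>-v'd \<le> L(A + C)\<close> by \<open>L\<close> times \<open>\<surd>a\<close> plus twice the \<open>\<ell>\<^sub>1\<close> distance of \<open>d\<close> to the line
  through \<open>e\<close> (\<open>noise_term_bound\<close>).  Optimising over the position of \<open>d\<close> relative to that line, one
  gets \<open>D \<le> L((1 + \<surd>20) P + \<surd>a)\<close> with \<open>P\<^sup>2 \<le> sD/\<phi>\<close>, and
  \<open>(1 + \<surd>20)\<^sup>2 < 32\<close> (\<open>penalty_share_bound\<close>).

  It remains to pay for the additional event.  For \<open>x = \<surd>(2 ln (p/\<eta>))\<close> a union bound over
  the \<open>2p\<close> coordinate directions costs \<open>2p P(Z > x) < p exp(-x\<^sup>2/2) = \<eta>\<close>.  With one more
  direction the budget still suffices when \<open>p \<ge> 2\<close>, since then \<open>x \<ge> 1\<close> and Mills' bound improves the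
  tail estimate; when \<open>p = 1\<close> the additional direction is one of the coordinate directions
  (\<open>tail_budget\<close> and \<open>card_noise_directions\<close>).
\<close>

section \<open>Upper tail of the standard normal law\<close>

lemma std_normal_half_line:
  "(\<integral>x. indicator {0..} x *\<^sub>R std_normal_density x \<partial>lborel) = 1 / 2"
proof -
  have int: "integrable lborel (\<lambda>x. indicator {0..} x *\<^sub>R std_normal_density x)"
    by (intro integrable_mult_indicator) auto
  have "has_bochner_integral lborel std_normal_density
          (2 *\<^sub>R (\<integral>x. indicator {0..} x *\<^sub>R std_normal_density x \<partial>lborel))"
    by (intro has_bochner_integral_even_function has_bochner_integral_integrable int)
       (simp add: std_normal_density_def)
  then have "(\<integral>x. std_normal_density x \<partial>lborel)
      = 2 * (\<integral>x. indicator {0..} x *\<^sub>R std_normal_density x \<partial>lborel)"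
    by (simp add: has_bochner_integral_integral_eq)
  then show ?thesis
    by simp
qed

definition std_normal_tail :: "real \<Rightarrow> real" where
  "std_normal_tail x = (\<integral>t. indicator {x<..} t *\<^sub>R std_normal_density t \<partial>lborel)"

lemma std_normal_tail_nonneg: "0 \<le> std_normal_tail x"
  by (simp add: std_normal_tail_def)

text \<open>Completing the square at the boundary: centred at \<open>x\<close>, the Gaussian density is
  \<open>exp (- x\<^sup>2 / 2)\<close> times the density at the origin, damped by \<open>exp (- x t)\<close>.\<close>
lemma std_normal_tail_shift:
  "std_normal_tail x
     = exp (- x\<^sup>2 / 2) * (\<integral>t. indicator {0<..} t *\<^sub>R (exp (- x * t) * std_normal_density t) \<partial>lborel)"
proof -
  have "std_normal_tail x
      = (\<integral>t. indicator {x<..} (x + 1 * t) *\<^sub>R std_normal_density (x + 1 * t) \<partial>lborel)"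
    unfolding std_normal_tail_def by (subst lborel_integral_real_affine [where c = 1 and t = x]) auto
  also have "\<dots> = (\<integral>t. exp (- x\<^sup>2 / 2) *
                      (indicator {0<..} t *\<^sub>R (exp (- x * t) * std_normal_density t)) \<partial>lborel)"
    by (intro Bochner_Integration.integral_cong)
       (auto simp: std_normal_density_def indicator_def power2_sum add_divide_distrib
          simp flip: exp_add exp_minus)
  finally show ?thesis
    by simp
qed

text \<open>The damping factor of \<open>std_normal_tail_shift\<close> is below one on the whole half line, whose mass is
  one half.  Strictness is what makes the final probability strictly larger than \<open>1 - \<eta>\<close>.\<close>
lemma std_normal_tail_less_half:
  assumes "0 < x"
  shows "std_normal_tail x < exp (- x\<^sup>2 / 2) / 2"
proof -
  let ?f = "\<lambda>t. indicator {0<..} t *\<^sub>R (exp (- x * t) * std_normal_density t)"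
  let ?g = "\<lambda>t. indicator {0..} t *\<^sub>R std_normal_density t"
  have g: "integrable lborel ?g"
    by (intro integrable_mult_indicator) auto
  have le: "?f t \<le> ?g t" for t
    using assms by (auto simp: indicator_def intro!: mult_left_le_one_le)
  have f: "integrable lborel ?f"
    by (rule Bochner_Integration.integrable_bound [OF g])
       (use le in \<open>auto simp: indicator_def intro!: AE_I2\<close>)
  have "(\<integral>t. ?f t \<partial>lborel) < (\<integral>t. ?g t \<partial>lborel)"
  proof (rule ccontr)
    assume "\<not> ?thesis"
    moreover have "0 \<le> (\<integral>t. ?g t - ?f t \<partial>lborel)"
      using le by (intro Bochner_Integration.integral_nonneg) auto
    ultimately have "(\<integral>t. ?g t - ?f t \<partial>lborel) = 0"
      using f g by simp
    then have "AE t in lborel. ?g t - ?f t = 0"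
      using f g le by (subst (asm) integral_nonneg_eq_0_iff_AE) auto
    moreover have "?g t - ?f t \<noteq> 0" if "t \<in> {0<..<1}" for t
      using that assms normal_density_pos [of 1 0 t] by (simp add: indicator_def)
    ultimately have "AE t in lborel. t \<notin> {0<..<(1 :: real)}"
      by (auto elim: eventually_mono)
    then have "{0<..<(1 :: real)} \<in> null_sets lborel"
      by (simp add: AE_iff_null_sets)
    then show False
      by (simp add: null_sets_def)
  qed
  also have "\<dots> = 1 / 2"
    by (rule std_normal_half_line)
  finally show ?thesis
    unfolding std_normal_tail_shift by simp
qed

text \<open>Mills' bound: beyond \<open>x\<close> the density is at most \<open>t / x\<close> times itself, and \<open>t\<close> times the density
  has minus the density as an antiderivative.\<close>
lemma std_normal_tail_mills:
  assumes "0 < x"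
  shows "std_normal_tail x \<le> exp (- x\<^sup>2 / 2) / (x * sqrt (2 * pi))"
proof -
  let ?F = "\<lambda>t. - std_normal_density t / x"
  have "ennreal (std_normal_tail x)
      = (\<integral>\<^sup>+t. ennreal (indicator {x<..} t *\<^sub>R std_normal_density t) \<partial>lborel)"
    unfolding std_normal_tail_def
    by (intro nn_integral_eq_integral [symmetric] integrable_mult_indicator) auto
  also have "\<dots> \<le> (\<integral>\<^sup>+t. ennreal (t / x * std_normal_density t) * indicator {x..} t \<partial>lborel)"
  proof (intro nn_integral_mono)
    fix t
    have "1 * std_normal_density t \<le> t / x * std_normal_density t" if "x < t"
      using that assms by (intro mult_right_mono) auto
    then show "ennreal (indicator {x<..} t *\<^sub>R std_normal_density t)
        \<le> ennreal (t / x * std_normal_density t) * indicator {x..} t"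
      by (auto simp: indicator_def intro!: ennreal_leI)
  qed
  also have "\<dots> = ennreal (0 - ?F x)"
  proof (rule nn_integral_FTC_atLeast [where F = ?F])
    show "DERIV ?F t :> t / x * std_normal_density t" for t
      unfolding std_normal_density_def using assms
      by (auto intro!: derivative_eq_intros simp: field_simps)
    show "(?F \<longlongrightarrow> 0) at_top"
      unfolding std_normal_density_def using assms by real_asymp
  qed (use assms in auto)
  finally show ?thesis
    using assms by (simp add: ennreal_le_iff std_normal_density_def mult_ac)
qed

text \<open>Here \<open>x\<close> is chosen so that \<open>p * exp (- x\<^sup>2 / 2) = \<eta>\<close>.  The crude tail bound pays for \<open>2p\<close>
  directions.  One more direction is a factor of at most \<open>5/4\<close> when \<open>p \<ge> 2\<close>; then
  \<open>x\<^sup>2 \<ge> 2 ln 2 \<ge> 1\<close>, and Mills' bound gains the factor \<open>x \<surd>(2\<pi>) > 5/2\<close>, where the crude bound has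
  only 2.\<close>
lemma tail_budget:
  fixes N p :: nat
  assumes "0 < \<eta>" "\<eta> < 1" "0 < p"
    and N: "N \<le> 2 * p \<or> N \<le> 2 * p + 1 \<and> 2 \<le> p"
    and x: "x = sqrt (2 * ln (real p / \<eta>))"
  shows "real N * std_normal_tail x < \<eta>"
proof -
  have ratio: "1 < real p / \<eta>"
    using assms by (simp add: less_divide_eq)
  then have ln_pos: "0 < ln (real p / \<eta>)"
    by simp
  then have x_pos: "0 < x" and x2: "x\<^sup>2 = 2 * ln (real p / \<eta>)"
    by (simp_all add: x)
  have exp_x: "exp (- x\<^sup>2 / 2) = \<eta> / real p"
    using ratio assms by (simp add: x2 exp_minus)
  consider "N \<le> 2 * p" | "N \<le> 2 * p + 1" "2 \<le> p"
    using N by blast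
  then show ?thesis
  proof cases
    case 1
    then have "real N * std_normal_tail x \<le> real (2 * p) * std_normal_tail x"
      by (intro mult_right_mono std_normal_tail_nonneg) simp
    also have "\<dots> < real (2 * p) * (exp (- x\<^sup>2 / 2) / 2)"
      using \<open>0 < p\<close> by (intro mult_strict_left_mono std_normal_tail_less_half x_pos) auto
    also have "\<dots> = \<eta>"
      using \<open>0 < p\<close> unfolding exp_x by simp
    finally show ?thesis .
  next
    case 2
    have "2 \<le> real p / \<eta>"
      using 2 assms by (simp add: le_divide_eq)
    then have "ln 2 \<le> ln (real p / \<eta>)"
      by (subst ln_le_cancel_iff) auto
    then have "1 \<le> x\<^sup>2"
      using ln2_ge_two_thirds x2 by linarith
    then have "1 \<le> x"
      using x_pos power2_le_imp_le [of 1 x] by simp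
    have "(5 / 2)\<^sup>2 < 2 * pi"
      using pi_approx by (simp add: power2_eq_square)
    then have "5 / 2 < 1 * sqrt (2 * pi)"
      using real_less_rsqrt [of "5 / 2" "2 * pi"] by linarith
    also have "1 * sqrt (2 * pi) \<le> x * sqrt (2 * pi)"
      using \<open>1 \<le> x\<close> by (intro mult_right_mono) auto
    finally have "5 / 2 < x * sqrt (2 * pi)"
      by simp
    then have lt: "(5 / 2) / (x * sqrt (2 * pi)) < 1"
      using x_pos by (subst divide_less_eq_1_pos) auto
    have "real N * std_normal_tail x \<le> 5 / 2 * real p * std_normal_tail x"
      using 2 by (intro mult_right_mono std_normal_tail_nonneg) linarith
    also have "\<dots> \<le> 5 / 2 * real p * (exp (- x\<^sup>2 / 2) / (x * sqrt (2 * pi)))"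
      by (intro mult_left_mono std_normal_tail_mills x_pos) auto
    also have "\<dots> = \<eta> * ((5 / 2) / (x * sqrt (2 * pi)))"
      using \<open>0 < p\<close> unfolding exp_x by simp
    also have "\<dots> < \<eta> * 1"
      using lt \<open>0 < \<eta>\<close> by (intro mult_strict_left_mono)
    finally show ?thesis
      by simp
  qed
qed

section \<open>Linear forms of Gaussian noise\<close>

lemma normal_tail_prob:
  assumes "prob_space M" and "distributed M lborel Z (normal_density 0 s)" and "0 < s"
  shows "measure M {\<omega> \<in> space M. s * x < Z \<omega>} = std_normal_tail x"
proof -
  interpret prob_space M by fact
  have "distributed M lborel (\<lambda>\<omega>. Z \<omega> / s) std_normal_density"
    using assms normal_standard_normal_convert [of s Z 0] by simp
  then have "emeasure M ((\<lambda>\<omega>. Z \<omega> / s) -` {x<..} \<inter> space M)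
      = (\<integral>\<^sup>+t. ennreal (std_normal_density t) * indicator {x<..} t \<partial>lborel)"
    by (rule distributed_emeasure) simp
  also have "\<dots> = (\<integral>\<^sup>+t. ennreal (indicator {x<..} t *\<^sub>R std_normal_density t) \<partial>lborel)"
    by (intro nn_integral_cong) (auto simp: indicator_def)
  also have "\<dots> = ennreal (std_normal_tail x)"
    unfolding std_normal_tail_def
    by (intro nn_integral_eq_integral integrable_mult_indicator) auto
  also have "(\<lambda>\<omega>. Z \<omega> / s) -` {x<..} \<inter> space M = {\<omega> \<in> space M. s * x < Z \<omega>}"
    using \<open>0 < s\<close> by (auto simp: field_simps)
  finally show ?thesis
    by (simp add: measure_def std_normal_tail_def)
qed

text \<open>The summation rule for independent normal variables requires positive variances, so the sum is
  taken over the indices with nonzero weight.\<close>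
lemma gaussian_linear_form:
  fixes \<epsilon> :: "'w \<Rightarrow> real ^ 'n"
  assumes "prob_space M" and "0 < \<sigma>"
    and gauss: "\<And>i. distributed M lborel (\<lambda>\<omega>. \<epsilon> \<omega> $ i) (normal_density 0 \<sigma>)"
    and indep: "prob_space.indep_vars M (\<lambda>_. borel) (\<lambda>i \<omega>. \<epsilon> \<omega> $ i) UNIV"
    and "w \<noteq> 0"
  shows "distributed M lborel (\<lambda>\<omega>. \<epsilon> \<omega> \<bullet> w) (normal_density 0 (\<sigma> * norm w))"
proof -
  interpret prob_space M by fact
  define I where "I = {i. w $ i \<noteq> 0}"
  have "I \<noteq> {}"
    using \<open>w \<noteq> 0\<close> by (auto simp: I_def vec_eq_iff)
  have "indep_vars (\<lambda>_. borel) (\<lambda>i \<omega>. w $ i * \<epsilon> \<omega> $ i) I"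
    by (rule indep_vars_compose2 [OF indep_vars_subset [OF indep]]) auto
  moreover have "distributed M lborel (\<lambda>\<omega>. w $ i * \<epsilon> \<omega> $ i) (normal_density 0 (\<bar>w $ i\<bar> * \<sigma>))"
    if "i \<in> I" for i
    using normal_density_affine [OF gauss [of i] \<open>0 < \<sigma>\<close>, of "w $ i" 0] that by (simp add: I_def)
  ultimately have "distributed M lborel (\<lambda>\<omega>. \<Sum>i\<in>I. w $ i * \<epsilon> \<omega> $ i)
      (normal_density (\<Sum>i\<in>I. 0) (sqrt (\<Sum>i\<in>I. (\<bar>w $ i\<bar> * \<sigma>)\<^sup>2)))"
    using \<open>I \<noteq> {}\<close> \<open>0 < \<sigma>\<close> by (intro sum_indep_normal) (auto simp: I_def)
  moreover have "(\<Sum>i\<in>I. w $ i * \<epsilon> \<omega> $ i) = \<epsilon> \<omega> \<bullet> w" for \<omega>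
    unfolding inner_vec_def
    by (rule sum.mono_neutral_cong_left) (auto simp: I_def mult.commute)
  moreover have "(\<Sum>i\<in>I. (\<bar>w $ i\<bar> * \<sigma>)\<^sup>2) = (\<Sum>i\<in>UNIV. (\<bar>w $ i\<bar> * \<sigma>)\<^sup>2)"
    by (rule sum.mono_neutral_left) (auto simp: I_def)
  moreover have "sqrt (\<Sum>i\<in>UNIV. (\<bar>w $ i\<bar> * \<sigma>)\<^sup>2) = \<sigma> * norm w"
    using \<open>0 < \<sigma>\<close>
    by (simp add: norm_vec_def L2_set_def power_mult_distrib real_sqrt_mult
        flip: sum_distrib_right)
  ultimately show ?thesis
    by simp
qed

text \<open>Directions of length zero are included: there the event is empty.  This covers vanishing design
  columns.\<close>
lemma gaussian_linear_form_tail: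
  fixes \<epsilon> :: "'w \<Rightarrow> real ^ 'n"
  assumes "prob_space M" and "0 < \<sigma>"
    and gauss: "\<And>i. distributed M lborel (\<lambda>\<omega>. \<epsilon> \<omega> $ i) (normal_density 0 \<sigma>)"
    and indep: "prob_space.indep_vars M (\<lambda>_. borel) (\<lambda>i \<omega>. \<epsilon> \<omega> $ i) UNIV"
  shows "measure M {\<omega> \<in> space M. \<sigma> * norm w * x < \<epsilon> \<omega> \<bullet> w} \<le> std_normal_tail x"
proof (cases "w = 0")
  case False
  then show ?thesis
    using normal_tail_prob [OF assms(1) gaussian_linear_form [OF assms False]] \<open>0 < \<sigma>\<close> by simp
qed (simp add: std_normal_tail_nonneg)

lemma gaussian_simultaneous_bound:
  fixes \<epsilon> :: "'w \<Rightarrow> real ^ 'n"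
  assumes "prob_space M" and "0 < \<sigma>"
    and gauss: "\<And>i. distributed M lborel (\<lambda>\<omega>. \<epsilon> \<omega> $ i) (normal_density 0 \<sigma>)"
    and indep: "prob_space.indep_vars M (\<lambda>_. borel) (\<lambda>i \<omega>. \<epsilon> \<omega> $ i) UNIV"
    and "finite W"
  shows "1 - real (card W) * std_normal_tail x
           \<le> measure M {\<omega> \<in> space M. \<forall>w\<in>W. \<epsilon> \<omega> \<bullet> w \<le> \<sigma> * norm w * x}"
proof -
  interpret prob_space M by fact
  let ?bad = "\<lambda>w. {\<omega> \<in> space M. \<sigma> * norm w * x < \<epsilon> \<omega> \<bullet> w}"
  have [measurable]: "(\<lambda>\<omega>. \<epsilon> \<omega> $ i) \<in> borel_measurable M" for i
    using distributed_measurable [OF gauss [of i]] by simp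
  have bad: "?bad w \<in> events" for w
    unfolding inner_vec_def by measurable
  have "prob (\<Union>w\<in>W. ?bad w) \<le> (\<Sum>w\<in>W. prob (?bad w))"
    using \<open>finite W\<close> bad by (intro measure_UNION_le) auto
  also have "\<dots> \<le> (\<Sum>w\<in>W. std_normal_tail x)"
    using assms by (intro sum_mono gaussian_linear_form_tail) auto
  finally have "1 - real (card W) * std_normal_tail x \<le> 1 - prob (\<Union>w\<in>W. ?bad w)"
    by simp
  also have "\<dots> = prob (space M - (\<Union>w\<in>W. ?bad w))"
    using \<open>finite W\<close> bad by (intro prob_compl [symmetric] sets.finite_UN) auto
  also have "space M - (\<Union>w\<in>W. ?bad w)
               = {\<omega> \<in> space M. \<forall>w\<in>W. \<epsilon> \<omega> \<bullet> w \<le> \<sigma> * norm w * x}"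
    by (auto simp: not_less)
  finally show ?thesis .
qed

section \<open>Norms and quadratic forms\<close>

lemma emp_norm_eq_norm: "emp_norm (a :: real ^ 'n) = norm a / sqrt (real CARD('n))"
  by (simp add: emp_norm_def norm_vec_def L2_set_def real_sqrt_divide)

lemma emp_norm_nonneg: "0 \<le> emp_norm a"
  by (simp add: emp_norm_eq_norm)

lemma emp_norm_sq: "(emp_norm (a :: real ^ 'n))\<^sup>2 = (a \<bullet> a) / real CARD('n)"
  by (simp add: emp_norm_eq_norm power_divide dot_square_norm)

lemma emp_norm_triangle: "emp_norm (a + b) \<le> emp_norm a + emp_norm b"
  unfolding emp_norm_eq_norm add_divide_distrib [symmetric]
  by (intro divide_right_mono norm_triangle_ineq) simp

lemma emp_norm_scaleR: "emp_norm (c *\<^sub>R a) = \<bar>c\<bar> * emp_norm a"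
  by (simp add: emp_norm_eq_norm)

lemma emp_norm_minus: "emp_norm (- a) = emp_norm a"
  by (simp add: emp_norm_eq_norm)

lemma inner_le_emp_norm:
  "((a :: real ^ 'n) \<bullet> b) / real CARD('n) \<le> emp_norm a * emp_norm b"
proof -
  have "a \<bullet> b \<le> norm a * norm b"
    by (rule norm_cauchy_schwarz)
  then show ?thesis
    by (simp add: emp_norm_eq_norm divide_right_mono)
qed

lemma l1_norm_pos: "b \<noteq> 0 \<Longrightarrow> 0 < l1_norm b"
proof -
  assume "b \<noteq> 0"
  then obtain j where "b $ j \<noteq> 0"
    by (auto simp: vec_eq_iff)
  then show ?thesis
    unfolding l1_norm_def by (intro sum_pos2 [where i = j]) auto
qed

lemma l1_norm_convex:
  assumes "0 \<le> t" "t \<le> 1"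
  shows "l1_norm (b + t *\<^sub>R (c - b)) \<le> l1_norm b + t * (l1_norm c - l1_norm b)"
proof -
  have "\<bar>b $ j + t * (c $ j - b $ j)\<bar> \<le> (1 - t) * \<bar>b $ j\<bar> + t * \<bar>c $ j\<bar>" for j
  proof -
    have "\<bar>b $ j + t * (c $ j - b $ j)\<bar> = \<bar>(1 - t) * b $ j + t * c $ j\<bar>"
      by (simp add: algebra_simps)
    also have "\<dots> \<le> \<bar>(1 - t) * b $ j\<bar> + \<bar>t * c $ j\<bar>"
      by (rule abs_triangle_ineq)
    finally show ?thesis
      using assms by (simp add: abs_mult)
  qed
  then have "l1_norm (b + t *\<^sub>R (c - b)) \<le> (\<Sum>j\<in>UNIV. (1 - t) * \<bar>b $ j\<bar> + t * \<bar>c $ j\<bar>)"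
    unfolding l1_norm_def by (intro sum_mono) simp
  also have "\<dots> = (1 - t) * l1_norm b + t * l1_norm c"
    by (simp add: l1_norm_def sum.distrib sum_distrib_left)
  also have "\<dots> = l1_norm b + t * (l1_norm c - l1_norm b)"
    by (simp add: algebra_simps)
  finally show ?thesis .
qed

lemma inner_le_l1_norm:
  fixes h d :: "real ^ 'p"
  assumes "\<And>j. \<bar>h $ j\<bar> \<le> B"
  shows "\<bar>h \<bullet> d\<bar> \<le> B * l1_norm d"
proof -
  have "\<bar>h \<bullet> d\<bar> \<le> (\<Sum>j\<in>UNIV. \<bar>h $ j * d $ j\<bar>)"
    unfolding inner_vec_def by (simp add: sum_abs)
  also have "\<dots> \<le> (\<Sum>j\<in>UNIV. B * \<bar>d $ j\<bar>)"
    by (intro sum_mono) (simp add: abs_mult assms mult_right_mono)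
  finally show ?thesis
    by (simp add: l1_norm_def sum_distrib_left)
qed

lemma emp_norm_design_le_l1_norm:
  fixes X :: "real ^ 'p ^ 'n"
  assumes "\<And>j. emp_norm (column j X) \<le> 1"
  shows "emp_norm (X *v u) \<le> l1_norm u"
proof -
  have col: "norm (column j X) \<le> sqrt (real CARD('n))" for j
    using assms [of j] by (simp add: emp_norm_eq_norm)
  have "norm (X *v u) \<le> (\<Sum>j\<in>UNIV. norm (u $ j *s column j X))"
    unfolding matrix_mult_sum by (rule norm_sum)
  also have "\<dots> \<le> (\<Sum>j\<in>UNIV. \<bar>u $ j\<bar> * sqrt (real CARD('n)))"
    by (intro sum_mono)
       (simp add: scalar_mult_eq_scaleR col mult_left_mono)
  finally show ?thesis
    by (simp add: emp_norm_eq_norm l1_norm_def sum_distrib_right [symmetric] pos_divide_le_eq)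
qed

lemma continuous_on_matrix_vector_mult:
  fixes A :: "real ^ 'p ^ 'n"
  assumes "continuous_on S f"
  shows "continuous_on S (\<lambda>b. A *v f b)"
  by (rule continuous_on_compose2 [OF matrix_vector_mult_linear_continuous_on assms subset_UNIV])

lemma inner_transpose_mult:
  fixes A :: "real ^ 'p ^ 'n"
  shows "(transpose A *v a) \<bullet> u = a \<bullet> (A *v u)"
  by (metis dot_lmul_matrix vector_transpose_matrix transpose_transpose)

lemma Jtilde_inner: "(Jtilde J *v a) \<bullet> u = (J *v a) \<bullet> (J *v u)"
  by (simp add: Jtilde_def dot_lmul_matrix flip: matrix_vector_mul_assoc)

lemma quad_form_Jtilde: "quad_form (Jtilde J) v = (J *v v) \<bullet> (J *v v)"
  by (metis quad_form_def Jtilde_inner inner_commute)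

lemma quad_form_Kmat:
  "quad_form (Kmat X J mu) v = (emp_norm (X *v v))\<^sup>2 + mu * quad_form (Jtilde J) v"
proof -
  have "v \<bullet> ((transpose X ** X) *v v) = (X *v v) \<bullet> (X *v v)"
    by (metis inner_commute inner_transpose_mult matrix_vector_mul_assoc)
  then show ?thesis
    by (simp add: quad_form_def Kmat_def Psi_def emp_norm_sq matrix_vector_mult_add_rdistrib
        inner_add_right flip: scaleR_matrix_vector_assoc)
qed

section \<open>Optimality conditions\<close>

text \<open>The rescaled correlations of the noise with the design columns; minus twice this vector is the
  gradient of the squared loss at the true parameter.\<close>
definition score :: "real ^ 'p ^ 'n \<Rightarrow> real ^ 'n \<Rightarrow> real ^ 'p" where
  "score X e = (1 / real CARD('n)) *\<^sub>R (transpose X *v e)"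

lemma score_inner:
  fixes X :: "real ^ 'p ^ 'n"
  shows "score X e \<bullet> u = (e \<bullet> (X *v u)) / real CARD('n)"
  by (simp add: score_def dot_lmul_matrix)

lemma linear_term_nonneg:
  fixes a c :: real
  assumes "\<And>t. 0 < t \<Longrightarrow> t \<le> 1 \<Longrightarrow> 0 \<le> t * a + t\<^sup>2 * c"
  shows "0 \<le> a"
proof (rule ccontr)
  assume "\<not> 0 \<le> a"
  define t where "t = min 1 (- a / (2 * (\<bar>c\<bar> + 1)))"
  have t: "0 < t" "t \<le> 1"
    using \<open>\<not> 0 \<le> a\<close> by (auto simp: t_def intro!: divide_neg_pos)
  have "0 \<le> t * (a + t * c)"
    using assms [OF t] by (simp add: power2_eq_square algebra_simps)
  then have "0 \<le> a + t * c"
    using t by (simp add: zero_le_mult_iff)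
  moreover have "t * c \<le> t * (\<bar>c\<bar> + 1)"
    using t by (intro mult_left_mono) auto
  moreover have "t * (\<bar>c\<bar> + 1) \<le> - a / (2 * (\<bar>c\<bar> + 1)) * (\<bar>c\<bar> + 1)"
    by (intro mult_right_mono) (auto simp: t_def)
  moreover have "- a / (2 * (\<bar>c\<bar> + 1)) * (\<bar>c\<bar> + 1) = - a / 2"
    by (simp add: field_simps)
  ultimately show False
    using \<open>\<not> 0 \<le> a\<close> by linarith
qed

text \<open>Variational inequality for the minimizer \<open>b\<close>: along the segment from \<open>b\<close> to \<open>c\<close> the smooth part of
  the objective is a quadratic polynomial in \<open>t\<close>, and the \<open>\<ell>\<^sub>1\<close> part lies below its chord, so the
  coefficient of \<open>t\<close> in the resulting upper bound of the increment cannot be negative.  Comparing the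
  objective only at the two endpoints would lose a factor of two in the quadratic terms.\<close>
lemma first_order_condition:
  fixes X :: "real ^ 'p ^ 'n" and J :: "real ^ 'p ^ 'd"
  assumes est: "is_quad_estimate X J lam mu y b" and "0 \<le> lam"
  shows "2 * ((y - X *v b) \<bullet> (X *v (c - b))) / real CARD('n)
           \<le> 2 * mu * ((J *v b) \<bullet> (J *v (c - b))) + lam * (l1_norm c - l1_norm b)"
proof -
  define u where "u = c - b"
  define q where "q = (X *v u) \<bullet> (X *v u) / real CARD('n) + mu * ((J *v u) \<bullet> (J *v u))"
  define a where "a = lam * (l1_norm c - l1_norm b) + 2 * mu * ((J *v b) \<bullet> (J *v u))
                        - 2 * ((y - X *v b) \<bullet> (X *v u)) / real CARD('n)"
  have "0 \<le> t * a + t\<^sup>2 * q" if "0 < t" "t \<le> 1" for t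
  proof -
    have "quad_objective X J lam mu y b \<le> quad_objective X J lam mu y (b + t *\<^sub>R u)"
      using est by (simp add: is_quad_estimate_def is_arg_min_def not_less)
    moreover have "lam * l1_norm (b + t *\<^sub>R u)
                     \<le> lam * (l1_norm b + t * (l1_norm c - l1_norm b))"
      unfolding u_def using that assms by (intro mult_left_mono l1_norm_convex) auto
    moreover have res: "y - X *v (b + t *\<^sub>R u) = (y - X *v b) - t *\<^sub>R (X *v u)"
      by (simp add: matrix_vector_right_distrib matrix_vector_mult_scaleR)
    have "(emp_norm (y - X *v (b + t *\<^sub>R u)))\<^sup>2
        = (emp_norm (y - X *v b))\<^sup>2 - 2 * t * ((y - X *v b) \<bullet> (X *v u)) / real CARD('n)
            + t\<^sup>2 * ((X *v u) \<bullet> (X *v u)) / real CARD('n)"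
      unfolding emp_norm_sq res add_divide_distrib [symmetric] diff_divide_distrib [symmetric]
      by (simp add: inner_diff_left inner_diff_right inner_commute power2_eq_square algebra_simps)
    moreover have "J *v (b + t *\<^sub>R u) = J *v b + t *\<^sub>R (J *v u)"
      by (simp add: matrix_vector_right_distrib matrix_vector_mult_scaleR)
    then have "quad_form (Jtilde J) (b + t *\<^sub>R u)
        = quad_form (Jtilde J) b + 2 * t * ((J *v b) \<bullet> (J *v u)) + t\<^sup>2 * ((J *v u) \<bullet> (J *v u))"
      unfolding quad_form_Jtilde
      by (simp add: inner_add_left inner_add_right inner_commute power2_eq_square)
    ultimately show ?thesis
      by (simp add: quad_objective_def a_def q_def algebra_simps)
  qed
  then have "0 \<le> a"
    by (rule linear_term_nonneg)
  then show ?thesis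
    by (simp add: a_def u_def)
qed

text \<open>The first-order condition in the direction of the true parameter.  Writing the residual and
  \<open>J *v b\<close> in terms of the error \<open>\<beta> - b\<close> produces the quadratic form of the error on the left and two
  linear terms on the right, the bias of the penalty and the noise.\<close>
lemma basic_inequality:
  fixes X :: "real ^ 'p ^ 'n" and J :: "real ^ 'p ^ 'd"
  assumes "is_quad_estimate X J lam mu (X *v \<beta> + e) b" and "0 \<le> lam"
  shows "quad_form (Kmat X J mu) (\<beta> - b)
           \<le> lam / 2 * (l1_norm \<beta> - l1_norm b) + mu * ((Jtilde J *v \<beta>) \<bullet> (\<beta> - b))
               - score X e \<bullet> (\<beta> - b)"
proof -
  have "(X *v \<beta> + e) - X *v b = X *v (\<beta> - b) + e"
    by (simp add: matrix_vector_mult_diff_distrib)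
  then have "2 * (((X *v \<beta> + e) - X *v b) \<bullet> (X *v (\<beta> - b))) / real CARD('n)
      = 2 * (emp_norm (X *v (\<beta> - b)))\<^sup>2 + 2 * (score X e \<bullet> (\<beta> - b))"
    by (simp only: emp_norm_sq score_inner inner_add_left distrib_left add_divide_distrib
        times_divide_eq_right)
  moreover have "(J *v b) \<bullet> (J *v (\<beta> - b))
                   = (Jtilde J *v \<beta>) \<bullet> (\<beta> - b) - quad_form (Jtilde J) (\<beta> - b)"
    by (simp add: Jtilde_inner quad_form_Jtilde matrix_vector_mult_diff_distrib inner_diff_left)
  then have "2 * mu * ((J *v b) \<bullet> (J *v (\<beta> - b)))
      = 2 * (mu * ((Jtilde J *v \<beta>) \<bullet> (\<beta> - b))) - 2 * (mu * quad_form (Jtilde J) (\<beta> - b))"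
    by (simp only: right_diff_distrib mult.assoc)
  ultimately show ?thesis
    using first_order_condition [OF assms, of \<beta>]
    unfolding quad_form_Kmat by linarith
qed

text \<open>The first-order condition in the direction of the origin.  The cross term between
  \<open>\<beta> - b\<close> and \<open>b\<close> survives only through the design, because the penalty contributes
  \<open>- mu * b'Jtilde b\<close> as a whole.\<close>
lemma shrinkage_inequality:
  fixes X :: "real ^ 'p ^ 'n" and J :: "real ^ 'p ^ 'd"
  assumes "is_quad_estimate X J lam mu (X *v \<beta> + e) b" and "0 \<le> lam"
  shows "lam / 2 * l1_norm b + mu * quad_form (Jtilde J) b
           \<le> (X *v (\<beta> - b)) \<bullet> (X *v b) / real CARD('n) + score X e \<bullet> b"
proof -
  have "(X *v \<beta> + e) - X *v b = X *v (\<beta> - b) + e"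
    by (simp add: matrix_vector_mult_diff_distrib)
  moreover have "X *v (- b) = - (X *v b)" "J *v (- b) = - (J *v b)"
    by (metis diff_0 matrix_vector_mult_0_right matrix_vector_mult_diff_distrib)+
  moreover have "l1_norm (0 :: real ^ 'p) = 0"
    by (simp add: l1_norm_def)
  ultimately show ?thesis
    using first_order_condition [OF assms, of 0]
    by (simp add: quad_form_Jtilde score_inner inner_add_left field_simps)
qed

text \<open>A nonzero estimate resists being shrunk to the origin only if the fit gains from it: half the
  \<open>\<ell>\<^sub>1\<close> penalty, \<open>lam / 2\<close> per unit of \<open>\<ell>\<^sub>1\<close> norm, has to be compensated by the noise, which accounts for at
  most \<open>lam / 8\<close>, and by the prediction error.\<close>
lemma nonzero_estimate_prediction_error:
  fixes X :: "real ^ 'p ^ 'n" and J :: "real ^ 'p ^ 'd"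
  assumes est: "is_quad_estimate X J lam mu (X *v \<beta> + e) b"
    and "0 \<le> lam" "0 \<le> mu"
    and normalized: "\<And>j. emp_norm (column j X) \<le> 1"
    and noise: "\<And>j. \<bar>score X e $ j\<bar> \<le> lam / 8"
    and "b \<noteq> 0"
  shows "3 * lam / 8 \<le> emp_norm (X *v (\<beta> - b))"
proof -
  have "0 \<le> mu * quad_form (Jtilde J) b"
    using \<open>0 \<le> mu\<close> by (simp add: quad_form_Jtilde)
  moreover have "(X *v (\<beta> - b)) \<bullet> (X *v b) / real CARD('n)
                   \<le> emp_norm (X *v (\<beta> - b)) * l1_norm b"
    using inner_le_emp_norm [of "X *v (\<beta> - b)" "X *v b"]
      mult_left_mono [OF emp_norm_design_le_l1_norm [OF normalized, of b]
        emp_norm_nonneg [of "X *v (\<beta> - b)"]]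
    by linarith
  moreover have "score X e \<bullet> b \<le> lam / 8 * l1_norm b"
    using inner_le_l1_norm [of "score X e", OF noise, of b] by linarith
  ultimately have "(lam / 2) * l1_norm b \<le> (emp_norm (X *v (\<beta> - b)) + lam / 8) * l1_norm b"
    using shrinkage_inequality [OF est \<open>0 \<le> lam\<close>] by (simp add: algebra_simps)
  then have "lam / 2 \<le> emp_norm (X *v (\<beta> - b)) + lam / 8"
    using l1_norm_pos [OF \<open>b \<noteq> 0\<close>] by (simp add: mult_le_cancel_right)
  then show ?thesis
    by simp
qed

section \<open>Deterministic oracle inequalities\<close>

definition sign_vec :: "real ^ 'p \<Rightarrow> real ^ 'p" where
  "sign_vec b = (\<chi> j. sgn (b $ j))"

lemma l1_norm_supp_split:
  "l1_norm d = (\<Sum>j\<in>supp b. \<bar>d $ j\<bar>) + (\<Sum>j\<in>- supp b. \<bar>d $ j\<bar>)"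
  unfolding l1_norm_def
  by (metis Compl_eq_Diff_UNIV add.commute finite_code subset_UNIV sum.subset_diff)

text \<open>On the support the bound \<open>\<bar>b\<^sub>j\<bar> \<ge> sgn \<beta>\<^sub>j * b\<^sub>j\<close> keeps the sign of the error, which the
  inner product with the sign vector needs; the triangle inequality would only give its absolute
  value.\<close>
lemma l1_norm_difference_le:
  "l1_norm \<beta> - l1_norm b
     \<le> (\<Sum>j\<in>supp \<beta>. sgn (\<beta> $ j) * (\<beta> - b) $ j) - (\<Sum>j\<in>- supp \<beta>. \<bar>(\<beta> - b) $ j\<bar>)"
proof -
  have "(\<Sum>j\<in>supp \<beta>. \<bar>\<beta> $ j\<bar>) - (\<Sum>j\<in>supp \<beta>. \<bar>b $ j\<bar>)
          \<le> (\<Sum>j\<in>supp \<beta>. sgn (\<beta> $ j) * (\<beta> - b) $ j)"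
    unfolding sum_subtractf [symmetric]
    by (intro sum_mono) (auto simp: supp_def sgn_if abs_if)
  moreover have "(\<Sum>j\<in>- supp \<beta>. \<bar>\<beta> $ j\<bar>) = 0"
    by (intro sum.neutral) (simp add: supp_def)
  moreover have "(\<Sum>j\<in>- supp \<beta>. \<bar>(\<beta> - b) $ j\<bar>) = (\<Sum>j\<in>- supp \<beta>. \<bar>b $ j\<bar>)"
    by (intro sum.cong) (simp_all add: supp_def)
  ultimately show ?thesis
    unfolding l1_norm_supp_split [of _ \<beta>] by linarith
qed

text \<open>Cauchy--Schwarz with its defect: the variance of \<open>f\<close>, here bounded below by the mean absolute
  deviation.\<close>
lemma deviation_from_mean:
  fixes f :: "'a \<Rightarrow> real"
  assumes "finite A" "A \<noteq> {}" "c = sum f A / real (card A)"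
  shows "(sum f A)\<^sup>2 + (\<Sum>j\<in>A. \<bar>f j - c\<bar>)\<^sup>2 \<le> real (card A) * (\<Sum>j\<in>A. (f j)\<^sup>2)"
proof -
  have s: "0 < real (card A)"
    using assms by (simp add: card_gt_0_iff)
  have "(\<Sum>j\<in>A. \<bar>f j - c\<bar>)\<^sup>2 \<le> (\<Sum>j\<in>A. \<bar>f j - c\<bar>\<^sup>2) * real (card A)"
    by (rule sum_squared_le_sum_of_squares)
  also have "(\<Sum>j\<in>A. \<bar>f j - c\<bar>\<^sup>2) = (\<Sum>j\<in>A. (f j)\<^sup>2) - 2 * c * sum f A + real (card A) * c\<^sup>2"
    by (simp add: power2_diff sum.distrib sum_subtractf sum_distrib_right [symmetric]
        sum_distrib_left [symmetric] mult.assoc mult.commute [of c])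
  also have "\<dots> * real (card A) = real (card A) * (\<Sum>j\<in>A. (f j)\<^sup>2) - (sum f A)\<^sup>2"
    using s by (simp add: assms(3) field_simps power2_eq_square)
  finally show ?thesis
    by simp
qed

text \<open>Noise along \<open>c *\<^sub>R w\<close> is bounded by the prediction norm of that vector, hence by the prediction
  norm of \<open>d\<close> up to the design image of the remainder \<open>d - c *\<^sub>R w\<close>.  The remainder is paid for
  twice, once in this exchange and once for its own noise.\<close>
lemma noise_term_bound:
  fixes X :: "real ^ 'p ^ 'n"
  assumes normalized: "\<And>j. emp_norm (column j X) \<le> 1"
    and noise: "\<And>j. \<bar>score X e $ j\<bar> \<le> L"
    and flat: "- (score X e \<bullet> w) \<le> L * emp_norm (X *v w)"
    and "0 \<le> c" "0 \<le> L"
  shows "- (score X e \<bullet> d) \<le> L * (emp_norm (X *v d) + 2 * l1_norm (d - c *\<^sub>R w))"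
proof -
  define r where "r = d - c *\<^sub>R w"
  have d: "d = c *\<^sub>R w + r"
    by (simp add: r_def)
  have Xr: "emp_norm (X *v r) \<le> l1_norm r"
    by (rule emp_norm_design_le_l1_norm [OF normalized])
  have "c * emp_norm (X *v w) = emp_norm (X *v d + - (X *v r))"
    using \<open>0 \<le> c\<close>
    by (simp add: d matrix_vector_right_distrib matrix_vector_mult_scaleR emp_norm_scaleR)
  also have "\<dots> \<le> emp_norm (X *v d) + l1_norm r"
    using emp_norm_triangle [of "X *v d" "- (X *v r)"] Xr by (simp add: emp_norm_minus)
  finally have 1: "L * (c * emp_norm (X *v w)) \<le> L * (emp_norm (X *v d) + l1_norm r)"
    using \<open>0 \<le> L\<close> by (rule mult_left_mono)
  have "- (score X e \<bullet> d) = c * - (score X e \<bullet> w) - score X e \<bullet> r"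
    by (simp add: d inner_add_right)
  also have "\<dots> \<le> c * (L * emp_norm (X *v w)) + L * l1_norm r"
    using mult_left_mono [OF flat \<open>0 \<le> c\<close>] inner_le_l1_norm [of "score X e", OF noise, of r]
    by linarith
  also have "\<dots> \<le> L * (emp_norm (X *v d) + 2 * l1_norm r)"
    using 1 by (simp add: algebra_simps)
  finally show ?thesis
    by (simp add: r_def)
qed

text \<open>For \<open>D \<le> k \<surd>(B D)\<close> one may cancel \<open>\<surd>D\<close>.\<close>
lemma quadratic_bound:
  fixes D B k :: real
  assumes "D \<le> k * P" "P\<^sup>2 \<le> B * D" "0 \<le> P" "0 \<le> D" "0 \<le> k" "0 \<le> B"
  shows "D \<le> k\<^sup>2 * B"
proof (cases "D = 0")
  case False
  have "D\<^sup>2 \<le> (k * P)\<^sup>2"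
    using assms by (intro power_mono) auto
  also have "\<dots> \<le> k\<^sup>2 * (B * D)"
    unfolding power_mult_distrib using assms by (intro mult_left_mono) auto
  finally have "D * D \<le> (k\<^sup>2 * B) * D"
    by (simp add: power2_eq_square algebra_simps)
  then show ?thesis
    using False \<open>0 \<le> D\<close> by (simp add: mult_le_cancel_right)
qed (use assms in simp)

text \<open>The constant \<open>11/2\<close> stands for \<open>1 + \<surd>20\<close>, and \<open>(11/2)\<^sup>2 = 121/4 < 32\<close>.  The bound concerns only
  the share \<open>b\<close> of \<open>a + b\<close>: since \<open>L r \<le> a/3\<close>, at least \<open>2/3\<close> of \<open>a\<close> stays on the left-hand side, and
  after squaring the mixed term \<open>4/3 a b\<close> dominates the one on the right.\<close>
lemma penalty_share_bound:
  fixes a b :: real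
  assumes "a + b \<le> L * (11 / 2 * P + r)"
    and "r\<^sup>2 = a" "3 * L \<le> r" "0 \<le> r" "0 \<le> B"
    and "P\<^sup>2 \<le> B * (a + b)"
  shows "b \<le> 32 * (L\<^sup>2 * B)"
proof (rule ccontr)
  assume "\<not> ?thesis"
  then have b: "32 * (L\<^sup>2 * B) < b"
    by simp
  moreover have "0 \<le> L\<^sup>2 * B"
    using \<open>0 \<le> B\<close> by simp
  ultimately have b_pos: "0 < b"
    by linarith
  have a: "0 \<le> a"
    using assms by auto
  have "3 * (L * r) \<le> a"
    using mult_right_mono [OF \<open>3 * L \<le> r\<close> \<open>0 \<le> r\<close>] \<open>r\<^sup>2 = a\<close>
    by (simp add: power2_eq_square)
  then have "b + 2 / 3 * a \<le> 11 / 2 * (L * P)"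
    using assms(1) by (simp add: algebra_simps)
  then have "(b + 2 / 3 * a)\<^sup>2 \<le> (11 / 2 * (L * P))\<^sup>2"
    using a b_pos by (intro power_mono) auto
  also have "\<dots> = 121 / 4 * L\<^sup>2 * P\<^sup>2"
    by (simp add: power_mult_distrib power2_eq_square)
  also have "\<dots> \<le> 121 / 4 * L\<^sup>2 * (B * (a + b))"
    using assms by (intro mult_left_mono) auto
  also have "\<dots> = 121 / 128 * (32 * (L\<^sup>2 * B)) * (a + b)"
    by simp
  also have "\<dots> \<le> 121 / 128 * b * (a + b)"
    using a b b_pos by (intro mult_right_mono mult_left_mono) auto
  finally have "7 / 128 * (b * b) + 149 / 384 * (a * b) + 4 / 9 * (a * a) \<le> 0"
    by (simp add: power2_eq_square algebra_simps)
  moreover have "0 < b * b" "0 \<le> a * b" "0 \<le> a * a"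
    using a b_pos by auto
  ultimately show False
    by linarith
qed

text \<open>The condition \<open>flat\<close> yields the bound on the penalty.  It is one-sided, and thus applies only if
  the coefficient of the projection of the error on the sign vector is nonnegative.  Otherwise
  \<open>l1_norm \<beta> \<le> l1_norm b\<close> by \<open>l1_norm_difference_le\<close>, and the crude noise bound already gives
  \<open>D \<le> 2LA\<close> instead of \<open>D \<le> 6LA\<close>.\<close>
lemma oracle_inequalities_for_good_noise:
  fixes X :: "real ^ 'p ^ 'n" and J :: "real ^ 'p ^ 'd"
  assumes est: "is_quad_estimate X J lam mu (X *v \<beta> + e) b"
    and normalized: "\<And>j. emp_norm (column j X) \<le> 1"
    and nondegenerate: "Jtilde J *v \<beta> \<noteq> 0"
    and "0 < lam" and mu: "mu = lam / (8 * infnorm (Jtilde J *v \<beta>))" and "0 < \<phi>"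
    and restricted_eigenvalue:
      "\<And>\<Delta> :: real ^ 'p.
         (\<Sum>j\<in>- supp \<beta>. \<bar>\<Delta> $ j\<bar>) \<le> 4 * (\<Sum>j\<in>supp \<beta>. \<bar>\<Delta> $ j\<bar>) \<Longrightarrow>
         quad_form (Kmat X J mu) \<Delta> \<ge> \<phi> * (\<Sum>j\<in>supp \<beta>. (\<Delta> $ j)\<^sup>2)"
    and noise: "\<And>j. \<bar>score X e $ j\<bar> \<le> lam / 8"
    and flat: "- (score X e \<bullet> sign_vec \<beta>) \<le> lam / 8 * emp_norm (X *v sign_vec \<beta>)"
  shows "(emp_norm (X *v \<beta> - X *v b))\<^sup>2 \<le> 4 * (1 / \<phi>) * lam\<^sup>2 * real (card (supp \<beta>))"
    and "quad_form (Jtilde J) (\<beta> - b)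
           \<le> 4 * (infnorm (Jtilde J *v \<beta>) / \<phi>) * lam * real (card (supp \<beta>))"
    and "l1_norm (\<beta> - b) \<le> 8 * (1 / \<phi>) * lam * real (card (supp \<beta>))"
proof -
  define L where "L = lam / 8"
  define H where "H = infnorm (Jtilde J *v \<beta>)"
  define s where "s = real (card (supp \<beta>))"
  define B where "B = s / \<phi>"
  define d where "d = \<beta> - b"
  define A where "A = (\<Sum>j\<in>supp \<beta>. \<bar>d $ j\<bar>)"
  define C where "C = (\<Sum>j\<in>- supp \<beta>. \<bar>d $ j\<bar>)"
  define S where "S = (\<Sum>j\<in>supp \<beta>. sgn (\<beta> $ j) * d $ j)"
  define Q where "Q = (\<Sum>j\<in>supp \<beta>. (d $ j)\<^sup>2)"
  define P where "P = sqrt (s * Q)"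
  define r where "r = emp_norm (X *v d)"
  define g where "g = mu * quad_form (Jtilde J) d"
  define D where "D = r\<^sup>2 + g"
  define N where "N = - (score X e \<bullet> d)"

  have L: "0 < L" and H: "0 < H"
    using \<open>0 < lam\<close> nondegenerate by (simp_all add: L_def H_def infnorm_pos_lt)
  have mu_pos: "0 < mu" and muH: "mu * H = L"
    using \<open>0 < lam\<close> H by (simp_all add: mu L_def flip: H_def)
  have supp_ne: "supp \<beta> \<noteq> {}"
  proof
    assume "supp \<beta> = {}"
    then have "\<beta> = 0"
      by (auto simp: supp_def vec_eq_iff)
    then show False
      using nondegenerate by simp
  qed
  have s: "0 < s"
    using supp_ne by (simp add: s_def card_gt_0_iff)
  have B: "0 < B"
    using s \<open>0 < \<phi>\<close> by (simp add: B_def)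
  have Q: "0 \<le> Q"
    by (simp add: Q_def sum_nonneg)
  then have nonneg: "0 \<le> A" "0 \<le> C" "0 \<le> Q" "0 \<le> P" "0 \<le> r" "0 \<le> g"
    using mu_pos s
    by (auto simp: A_def C_def P_def r_def g_def quad_form_Jtilde emp_norm_nonneg
        intro!: sum_nonneg)
  then have D0: "0 \<le> D"
    by (simp add: D_def)

  have l1d: "l1_norm d = A + C"
    unfolding A_def C_def by (rule l1_norm_supp_split)
  have bias: "mu * ((Jtilde J *v \<beta>) \<bullet> u) \<le> L * l1_norm u" for u
  proof -
    have "\<bar>(mu *\<^sub>R (Jtilde J *v \<beta>)) $ j\<bar> \<le> L" for j
    proof -
      have "mu * \<bar>(Jtilde J *v \<beta>) $ j\<bar> \<le> mu * H"
        unfolding H_def using mu_pos by (intro mult_left_mono component_le_infnorm_cart) auto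
      then show ?thesis
        using mu_pos by (simp add: abs_mult muH)
    qed
    from inner_le_l1_norm [of "mu *\<^sub>R (Jtilde J *v \<beta>)", OF this, of u] show ?thesis
      by simp
  qed
  have "D \<le> 4 * L * (l1_norm \<beta> - l1_norm b) + L * (A + C) + N"
    using basic_inequality [OF est] \<open>0 < lam\<close> bias [of d]
    by (simp add: D_def N_def L_def l1d r_def g_def quad_form_Kmat flip: d_def)
  moreover have "4 * L * (l1_norm \<beta> - l1_norm b) \<le> 4 * L * (S - C)"
    using l1_norm_difference_le [of \<beta> b] L
    by (intro mult_left_mono) (auto simp: S_def C_def d_def)
  ultimately have basic: "D \<le> 4 * L * (S - C) + L * (A + C) + N"
    by linarith
  have N: "N \<le> L * (A + C)"
    using inner_le_l1_norm [of "score X e", OF noise, of d] by (simp add: N_def L_def l1d)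
  have SA: "S \<le> A"
    unfolding S_def A_def by (intro sum_mono) (auto simp: sgn_if)
  \<comment> \<open>The crude noise bound, sufficient for the cone condition and two of the three claims.\<close>
  have "D \<le> 4 * L * (A - C) + 2 * (L * (A + C))"
  proof -
    have "L * S \<le> L * A"
      using SA L by (intro mult_left_mono) auto
    then show ?thesis
      using basic N by (simp add: algebra_simps)
  qed
  then have D_le: "D \<le> L * (6 * A - 2 * C)"
    by (simp add: algebra_simps)
  with D0 have "0 \<le> 6 * A - 2 * C"
    using L by (metis order_trans zero_le_mult_iff not_less)
  then have C: "C \<le> 3 * A"
    by simp

  have "\<phi> * Q \<le> D"
    using restricted_eigenvalue [of d] C nonneg
    unfolding A_def C_def Q_def D_def r_def g_def quad_form_Kmat by linarith
  then have "s * (\<phi> * Q) \<le> s * D"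
    using s by (intro mult_left_mono) auto
  then have sQ: "s * Q \<le> B * D"
    using \<open>0 < \<phi>\<close> by (simp add: B_def field_simps)
  have P2: "P\<^sup>2 = s * Q"
    using s nonneg by (simp add: P_def)
  have P2_le: "P\<^sup>2 \<le> B * D"
    using sQ by (simp add: P2)
  have "A\<^sup>2 \<le> Q * s"
    using sum_squared_le_sum_of_squares [of "\<lambda>j. \<bar>d $ j\<bar>" "supp \<beta>"]
    by (simp add: A_def Q_def s_def)
  then have A2: "A\<^sup>2 \<le> P\<^sup>2"
    by (simp add: P2 mult.commute)
  then have AP: "A \<le> P"
    using nonneg by (rule_tac power2_le_imp_le) auto
  have A2_le: "A\<^sup>2 \<le> B * D"
    using A2 P2_le by linarith

  have "D \<le> (6 * L) * A"
  proof -
    have "0 \<le> L * C"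
      using L nonneg by simp
    then show ?thesis
      using D_le by (simp add: algebra_simps)
  qed
  then have D36: "D \<le> (6 * L)\<^sup>2 * B"
    using A2_le nonneg D0 L B by (intro quadratic_bound [where P = A]) auto
  have "A\<^sup>2 \<le> B * ((6 * L)\<^sup>2 * B)"
    using A2_le mult_left_mono [OF D36, of B] B by linarith
  then have "A\<^sup>2 \<le> (6 * (L * B))\<^sup>2"
    by (simp add: power2_eq_square algebra_simps)
  then have A6: "A \<le> 6 * (L * B)"
    using L B by (rule_tac power2_le_imp_le) auto

  have LLB: "0 \<le> L\<^sup>2 * B" and LB: "0 \<le> L * B"
    using L B by auto
  have "g \<le> 32 * (L\<^sup>2 * B)"
  proof (cases "b = 0")
    case True
    then have [simp]: "d = \<beta>"
      by (simp add: d_def)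
    have "C = 0"
      unfolding C_def by (intro sum.neutral) (simp add: supp_def)
    \<comment> \<open>The error is the true parameter, so the penalty is itself a bias term, linear in \<open>A\<close>.\<close>
    have "g \<le> L * A"
      using bias [of \<beta>] l1d \<open>C = 0\<close> by (simp add: g_def quad_form_Jtilde Jtilde_inner)
    also have "\<dots> \<le> L * (6 * (L * B))"
      using A6 L by (intro mult_left_mono) auto
    also have "\<dots> \<le> 32 * (L\<^sup>2 * B)"
      using LLB by (simp add: power2_eq_square mult_ac)
    finally show ?thesis .
  next
    case b_ne: False
    show ?thesis
    proof (cases "0 \<le> S")
      case True
      \<comment> \<open>\<open>c\<close> is the coefficient of the orthogonal projection on the sign vector.\<close>
      define c where "c = S / s"
      define R where "R = (\<Sum>j\<in>supp \<beta>. \<bar>sgn (\<beta> $ j) * d $ j - c\<bar>)"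
      have "S\<^sup>2 + R\<^sup>2 \<le> s * (\<Sum>j\<in>supp \<beta>. (sgn (\<beta> $ j) * d $ j)\<^sup>2)"
        unfolding S_def R_def s_def using supp_ne
        by (intro deviation_from_mean) (auto simp: c_def S_def s_def)
      also have "(\<Sum>j\<in>supp \<beta>. (sgn (\<beta> $ j) * d $ j)\<^sup>2) = Q"
        unfolding Q_def by (intro sum.cong) (auto simp: supp_def sgn_if)
      finally have SR: "S\<^sup>2 + R\<^sup>2 \<le> P\<^sup>2"
        by (simp add: P2)
      \<comment> \<open>Cauchy--Schwarz in the plane: \<open>S\<close> and \<open>R\<close> are bounded by the legs of a right triangle with
        hypotenuse \<open>P\<close>, and \<open>4\<^sup>2 + 2\<^sup>2 = 20 \<le> (9/2)\<^sup>2\<close>.\<close>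
      have "(4 * S + 2 * R)\<^sup>2 = 20 * (S\<^sup>2 + R\<^sup>2) - (2 * S - 4 * R)\<^sup>2"
        by (simp add: power2_eq_square algebra_simps)
      also have "\<dots> \<le> 20 * (S\<^sup>2 + R\<^sup>2)"
        by simp
      also have "\<dots> \<le> 20 * P\<^sup>2"
        using SR by simp
      also have "\<dots> \<le> (9 / 2 * P)\<^sup>2"
        by (simp add: power_mult_distrib power_divide)
      finally have SR_le: "4 * S + 2 * R \<le> 9 / 2 * P"
        using nonneg by (rule_tac power2_le_imp_le) auto
      have "(\<Sum>j\<in>supp \<beta>. \<bar>(d - c *\<^sub>R sign_vec \<beta>) $ j\<bar>) = R"
        unfolding R_def by (intro sum.cong) (auto simp: supp_def sign_vec_def sgn_if)
      moreover have "(\<Sum>j\<in>- supp \<beta>. \<bar>(d - c *\<^sub>R sign_vec \<beta>) $ j\<bar>) = C"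
        unfolding C_def by (intro sum.cong) (auto simp: supp_def sign_vec_def)
      ultimately have "l1_norm (d - c *\<^sub>R sign_vec \<beta>) = R + C"
        unfolding l1_norm_supp_split [of _ \<beta>] by simp
      then have "N \<le> L * (r + 2 * (R + C))"
        using noise_term_bound [of X e "lam / 8", OF normalized noise flat, of c d] True s \<open>0 < lam\<close>
        by (simp add: N_def L_def r_def c_def)
      with basic have "D \<le> L * ((4 * S + 2 * R) + (A - C) + r)"
        by (simp add: algebra_simps)
      also have "\<dots> \<le> L * (11 / 2 * P + r)"
        using SR_le AP nonneg L by (intro mult_left_mono) auto
      finally have "r\<^sup>2 + g \<le> L * (11 / 2 * P + r)"
        by (simp add: D_def)
      moreover have "3 * L \<le> r"
        using nonzero_estimate_prediction_error [OF est _ _ normalized noise b_ne] \<open>0 < lam\<close> mu_pos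
        by (simp add: L_def r_def d_def)
      ultimately show ?thesis
        using nonneg L B P2_le by (intro penalty_share_bound [of "r\<^sup>2" g L P r]) (auto simp: D_def)
    next
      case False
      then have "L * S \<le> 0"
        using L by (simp add: mult_nonneg_nonpos)
      then have "D \<le> 2 * (L * A) - 2 * (L * C)"
        using basic N by (simp add: algebra_simps)
      moreover have "0 \<le> L * C"
        using L nonneg by simp
      ultimately have "D \<le> (2 * L) * A"
        by simp
      then have "D \<le> (2 * L)\<^sup>2 * B"
        using A2_le nonneg D0 L B by (intro quadratic_bound [where P = A]) auto
      moreover have "(2 * L)\<^sup>2 * B = 4 * (L\<^sup>2 * B)"
        by (simp add: power_mult_distrib)
      moreover have "g \<le> D"
        by (simp add: D_def)
      ultimately show ?thesis
        using LLB by linarith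
    qed
  qed
  then have "g \<le> mu * (32 * L * B * H)"
    by (simp add: power2_eq_square flip: muH) (simp add: algebra_simps)
  then have "quad_form (Jtilde J) d \<le> 32 * L * B * H"
    using mu_pos by (simp add: g_def)
  then show "quad_form (Jtilde J) (\<beta> - b)
      \<le> 4 * (infnorm (Jtilde J *v \<beta>) / \<phi>) * lam * real (card (supp \<beta>))"
    by (simp add: L_def B_def s_def d_def H_def algebra_simps)

  have "r\<^sup>2 \<le> 256 * (L\<^sup>2 * B)"
    using D36 LLB nonneg by (simp add: D_def power_mult_distrib)
  then show "(emp_norm (X *v \<beta> - X *v b))\<^sup>2 \<le> 4 * (1 / \<phi>) * lam\<^sup>2 * real (card (supp \<beta>))"
    by (simp add: r_def d_def L_def B_def s_def power_divide matrix_vector_mult_diff_distrib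
        algebra_simps)

  have "A + C \<le> 64 * (L * B)"
    using A6 C LB by linarith
  then show "l1_norm (\<beta> - b) \<le> 8 * (1 / \<phi>) * lam * real (card (supp \<beta>))"
    using l1d by (simp add: d_def L_def B_def s_def algebra_simps)
qed

section \<open>Oracle inequalities with high probability\<close>

definition noise_directions :: "real ^ 'p ^ 'n \<Rightarrow> real ^ 'p \<Rightarrow> (real ^ 'n) set" where
  "noise_directions X \<beta> =
     insert (- (X *v sign_vec \<beta>)) (range (\<lambda>j. column j X) \<union> range (\<lambda>j. - column j X))"

lemma finite_noise_directions: "finite (noise_directions X \<beta>)"
  by (simp add: noise_directions_def)

text \<open>For a single regressor the sign vector is \<open>1\<close> or \<open>-1\<close>, so its image is already a column up to
  sign; this case has no slack in \<open>tail_budget\<close> for a further direction.\<close>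
lemma card_noise_directions:
  fixes X :: "real ^ 'p ^ 'n"
  assumes "\<beta> \<noteq> 0"
  shows "card (noise_directions X \<beta>) \<le> 2 * CARD('p)
           \<or> card (noise_directions X \<beta>) \<le> 2 * CARD('p) + 1 \<and> 2 \<le> CARD('p)"
proof -
  let ?U = "range (\<lambda>j. column j X) \<union> range (\<lambda>j. - column j X)"
  have "card ?U \<le> card (range (\<lambda>j. column j X)) + card (range (\<lambda>j. - column j X))"
    by (rule card_Un_le)
  also have "\<dots> \<le> CARD('p) + CARD('p)"
    by (intro add_mono card_image_le) auto
  finally have U: "card ?U \<le> 2 * CARD('p)"
    by simp
  show ?thesis
  proof (cases "2 \<le> CARD('p)")
    case True
    then show ?thesis
      using U card_insert_le_m1 [of "Suc (2 * CARD('p))" ?U "- (X *v sign_vec \<beta>)"]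
      by (simp add: noise_directions_def)
  next
    case False
    then have "CARD('p) = 1"
      using zero_less_card_finite [where 'a = 'p] by linarith
    then obtain k :: 'p where k: "UNIV = {k}"
      by (auto simp: card_1_singleton_iff)
    then have all_k: "j = k" for j
      by (metis UNIV_I singletonD)
    then have "\<beta> $ k \<noteq> 0"
      using assms by (metis vec_eq_iff zero_index)
    moreover have "X *v sign_vec \<beta> = sgn (\<beta> $ k) *\<^sub>R column k X"
      unfolding matrix_mult_sum k by (simp add: sign_vec_def scalar_mult_eq_scaleR)
    ultimately have "- (X *v sign_vec \<beta>) \<in> ?U"
      by (auto simp: sgn_if)
    then show ?thesis
      using U by (simp add: noise_directions_def insert_absorb)
  qed
qed

text \<open>Dividing by the sample size turns the bound in a direction \<open>w\<close> into one relative to \<open>emp_norm w\<close>;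
  the normalization of the columns makes it uniform over the coordinates.\<close>
lemma noise_conditions:
  fixes X :: "real ^ 'p ^ 'n"
  assumes normalized: "\<And>j. emp_norm (column j X) \<le> 1" and "0 \<le> \<sigma>" "0 \<le> x"
    and dirs: "\<And>w. w \<in> noise_directions X \<beta> \<Longrightarrow> e \<bullet> w \<le> \<sigma> * norm w * x"
    and L: "L = \<sigma> * x / sqrt (real CARD('n))"
  shows "\<bar>score X e $ j\<bar> \<le> L"
    and "- (score X e \<bullet> sign_vec \<beta>) \<le> L * emp_norm (X *v sign_vec \<beta>)"
proof -
  have scaled: "(e \<bullet> w) / real CARD('n) \<le> L * emp_norm w" if "w \<in> noise_directions X \<beta>" for w
    using divide_right_mono [OF dirs [OF that], of "real CARD('n)"]
    by (simp add: L emp_norm_eq_norm mult_ac)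
  have "0 \<le> L"
    using assms by simp
  then have "L * emp_norm (column j X) \<le> L"
    using mult_left_mono [OF normalized [of j]] by simp
  moreover have "score X e $ j = (e \<bullet> column j X) / real CARD('n)"
    using score_inner [of X e "axis j 1"] by (simp add: inner_axis matrix_vector_mult_basis)
  ultimately show "\<bar>score X e $ j\<bar> \<le> L"
    using scaled [of "column j X"] scaled [of "- column j X"]
    by (auto simp: noise_directions_def emp_norm_minus abs_le_iff)
  show "- (score X e \<bullet> sign_vec \<beta>) \<le> L * emp_norm (X *v sign_vec \<beta>)"
    using scaled [of "- (X *v sign_vec \<beta>)"]
    by (simp add: noise_directions_def emp_norm_minus score_inner)
qed

theorem theorem3:
  fixes M :: "'w measure"
    and X :: "real ^ 'p ^ 'n"
    and J :: "real ^ 'p ^ 'd"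
    and \<beta>s :: "real ^ 'p"
    and \<epsilon> Y :: "'w \<Rightarrow> real ^ 'n"
    and \<beta>hat :: "'w \<Rightarrow> real ^ 'p"
    and \<sigma> \<eta> lam mu \<phi> :: real
  assumes prob: "prob_space M"
    and sigma: "\<sigma> > 0"
    and gauss: "\<And>i. distributed M lborel (\<lambda>\<omega>. \<epsilon> \<omega> $ i) (normal_density 0 \<sigma>)"
    and indep: "prob_space.indep_vars M (\<lambda>_. borel) (\<lambda>i \<omega>. \<epsilon> \<omega> $ i) UNIV"
    and model: "\<And>\<omega>. \<omega> \<in> space M \<Longrightarrow> Y \<omega> = X *v \<beta>s + \<epsilon> \<omega>"
    and normalized: "\<And>j. emp_norm (column j X) \<le> 1"
    and nondegenerate: "Jtilde J *v \<beta>s \<noteq> 0"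
    and eta: "0 < \<eta>" "\<eta> < 1"
    and lam: "lam = 8 * sqrt 2 * \<sigma> * sqrt (ln (real CARD('p) / \<eta>) / real CARD('n))"
    and mu: "mu = lam / (8 * infnorm (Jtilde J *v \<beta>s))"
    and est_measurable: "\<beta>hat \<in> borel_measurable M"
    and est: "\<And>\<omega>. \<omega> \<in> space M \<Longrightarrow> is_quad_estimate X J lam mu (Y \<omega>) (\<beta>hat \<omega>)"
    and phi: "\<phi> > 0"
    and restricted_eigenvalue:
      "\<And>\<Delta> :: real ^ 'p.
         (\<Sum>j\<in>- supp \<beta>s. \<bar>\<Delta> $ j\<bar>) \<le> 4 * (\<Sum>j\<in>supp \<beta>s. \<bar>\<Delta> $ j\<bar>) \<Longrightarrow>
         quad_form (Kmat X J mu) \<Delta> \<ge> \<phi> * (\<Sum>j\<in>supp \<beta>s. (\<Delta> $ j)\<^sup>2)"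
  shows "measure M {\<omega> \<in> space M.
           (emp_norm (X *v \<beta>s - X *v \<beta>hat \<omega>))\<^sup>2
             \<le> 4 * (1 / \<phi>) * lam\<^sup>2 * real (card (supp \<beta>s)) \<and>
           quad_form (Jtilde J) (\<beta>s - \<beta>hat \<omega>)
             \<le> 4 * (infnorm (Jtilde J *v \<beta>s) / \<phi>) * lam * real (card (supp \<beta>s)) \<and>
           l1_norm (\<beta>s - \<beta>hat \<omega>)
             \<le> 8 * (1 / \<phi>) * lam * real (card (supp \<beta>s))}
         > 1 - \<eta>"
proof -
  interpret prob_space M by (rule prob)
  define x where "x = sqrt (2 * ln (real CARD('p) / \<eta>))"
  define good where "good = {\<omega> \<in> space M. \<forall>w\<in>noise_directions X \<beta>s. \<epsilon> \<omega> \<bullet> w \<le> \<sigma> * norm w * x}"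
  let ?concl = "\<lambda>b. (emp_norm (X *v \<beta>s - X *v b))\<^sup>2
             \<le> 4 * (1 / \<phi>) * lam\<^sup>2 * real (card (supp \<beta>s)) \<and>
           quad_form (Jtilde J) (\<beta>s - b)
             \<le> 4 * (infnorm (Jtilde J *v \<beta>s) / \<phi>) * lam * real (card (supp \<beta>s)) \<and>
           l1_norm (\<beta>s - b)
             \<le> 8 * (1 / \<phi>) * lam * real (card (supp \<beta>s))"

  have "1 \<le> real CARD('p)"
    using zero_less_card_finite [where 'a = 'p] by linarith
  then have "\<eta> < real CARD('p)"
    using eta by linarith
  then have "1 < real CARD('p) / \<eta>"
    using eta by (simp add: less_divide_eq)
  then have x_pos: "0 < x"
    by (simp add: x_def)
  have lam_x: "lam / 8 = \<sigma> * x / sqrt (real CARD('n))"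
    by (simp add: lam x_def real_sqrt_mult real_sqrt_divide)
  have lam_pos: "0 < lam"
  proof -
    have "0 < lam / 8"
      unfolding lam_x using x_pos sigma by (intro divide_pos_pos mult_pos_pos) auto
    then show ?thesis
      by simp
  qed

  have concl: "?concl (\<beta>hat \<omega>)" if "\<omega> \<in> good" for \<omega>
  proof -
    have \<omega>: "\<omega> \<in> space M"
      and dirs: "\<And>w. w \<in> noise_directions X \<beta>s \<Longrightarrow> \<epsilon> \<omega> \<bullet> w \<le> \<sigma> * norm w * x"
      using that by (auto simp: good_def)
    have est': "is_quad_estimate X J lam mu (X *v \<beta>s + \<epsilon> \<omega>) (\<beta>hat \<omega>)"
      using est [OF \<omega>] model [OF \<omega>] by simp
    have noise: "\<bar>score X (\<epsilon> \<omega>) $ j\<bar> \<le> lam / 8" for j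
      by (rule noise_conditions(1) [where \<sigma> = \<sigma> and x = x and \<beta> = \<beta>s])
         (use normalized sigma x_pos dirs lam_x in auto)
    have flat: "- (score X (\<epsilon> \<omega>) \<bullet> sign_vec \<beta>s) \<le> lam / 8 * emp_norm (X *v sign_vec \<beta>s)"
      by (rule noise_conditions(2) [where \<sigma> = \<sigma> and x = x])
         (use normalized sigma x_pos dirs lam_x in auto)
    note bounds = oracle_inequalities_for_good_noise
      [OF est' normalized nondegenerate lam_pos mu phi _ noise flat]
    show ?thesis
      by (intro conjI bounds restricted_eigenvalue)
  qed
  have "good \<subseteq> {\<omega> \<in> space M. ?concl (\<beta>hat \<omega>)}"
  proof
    fix \<omega> assume "\<omega> \<in> good"
    moreover from this have "\<omega> \<in> space M"
      by (simp add: good_def)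
    ultimately show "\<omega> \<in> {\<omega> \<in> space M. ?concl (\<beta>hat \<omega>)}"
      using concl [of \<omega>] by blast
  qed
  moreover have "{\<omega> \<in> space M. ?concl (\<beta>hat \<omega>)} \<in> sets M"
  proof -
    have "continuous_on UNIV (\<lambda>b. (emp_norm (X *v \<beta>s - X *v b))\<^sup>2)"
      unfolding emp_norm_sq
      by (intro continuous_intros continuous_on_matrix_vector_mult) simp
    moreover have "continuous_on UNIV (\<lambda>b. quad_form (Jtilde J) (\<beta>s - b))"
      unfolding quad_form_def
      by (intro continuous_intros continuous_on_matrix_vector_mult)
    moreover have "continuous_on UNIV (\<lambda>b. l1_norm (\<beta>s - b))"
      unfolding l1_norm_def by (intro continuous_intros)
    ultimately have "closed {b. ?concl b}"
      by (intro closed_Collect_conj closed_Collect_le continuous_on_const)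
    then have "\<beta>hat -` {b. ?concl b} \<inter> space M \<in> sets M"
      by (intro measurable_sets [OF est_measurable] borel_closed)
    then show ?thesis
      by (simp add: vimage_def Int_def conj_commute)
  qed
  ultimately have "prob good \<le> prob {\<omega> \<in> space M. ?concl (\<beta>hat \<omega>)}"
    by (rule finite_measure_mono)
  moreover have "1 - real (card (noise_directions X \<beta>s)) * std_normal_tail x \<le> prob good"
    unfolding good_def
    by (rule gaussian_simultaneous_bound [OF prob sigma gauss indep finite_noise_directions])
  moreover have "\<beta>s \<noteq> 0"
    using nondegenerate by auto
  then have "real (card (noise_directions X \<beta>s)) * std_normal_tail x < \<eta>"
    by (intro tail_budget [OF eta zero_less_card_finite card_noise_directions x_def])
  ultimately show ?thesis
    by linarith
qed

end
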